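(* For the production-inventory problem with $E\ge 1$ factories, $T\ge 1$ time periods and no lead times ($\delta_e=0$ for all $e\in[E]$), for every active set $\mathcal{A}\subseteq\{(t,s,e): 1\le s\le t\le T+1,\ e\in[E]\}$ the total number of unique tuples $K^{\mathcal{A}}$ satisfies $$K^{\mathcal{A}}\le 4|\mathcal{A}|+ET+5T+E+1.$$
   Context: $[k]=\{1,\dots,k\}$. The production-inventory problem (no lead times) has stages $t=1,\dots,T+1$, decisions $x_{te}\in\mathbb{R}$ for $t\in[T+1]$, $e\in[E]$ (the decisions of stage $T+1$ are dummy decisions with capacity $p_{T+1,e}=0$), and uncertain variables $\zeta_1,\dots,\zeta_{T+1}$ with $\zeta_1=1$. Its objective function is $\sum_{t=1}^{T+1}\sum_{e=1}^E c_{te}x_{te}$, and its constraints are: $\sum_{t=1}^{T+1}x_{te}\le Q_e$ for $e\in[E]$; $0\le x_{te}\le p_{te}$ for $e\in[E]$, $t\in[T+1]$; and $V_{\min}\le v_1+\sum_{e=1}^E\sum_{\ell=1}^{t}x_{\ell e}-\sum_{s=2}^{t+1}\zeta_s\le V_{\max}$ for $t\in[T]$. Here $c_{te},p_{te},Q_e,V_{\min},V_{\max},v_1$ are real numbers. Write the objective as $\sum_{t,e}a_{0,t,e}x_{te}-\sum_{s}b_{0,s}\zeta_s$ (so $a_{0,t,e}=c_{te}$, $b_{0,s}=0$) and each constraint, each two-sided constraint being split into two "$\le$" inequalities, as $\sum_{t=1}^{T+1}\sum_{e=1}^E a_{i,t,e}x_{te}-\sum_{s=1}^{T+1}b_{i,s}\zeta_s\le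 c_i$ for $i\in\{1,\dots,m\}$, where all constants (including $v_1$) are placed in the right-hand side $c_i$, so that $b_{i,1}=0$ for all $i$. For $\mathcal{A}$ and $s\in[T+1]$ define the set of tuples $$\mathcal{K}^{\mathcal{A},s}=\bigcup_{i=0}^m\Big\{\big(b_{i,s},(a_{i,t,e})_{t,e:(t,s,e)\in\mathcal{A}}\big)\Big\},$$ let $K^{\mathcal{A},s}=|\mathcal{K}^{\mathcal{A},s}|$, and let $K^{\mathcal{A}}=\sum_{s=1}^{T+1}K^{\mathcal{A},s}$. *)

theory Defs
  imports Complex_Main "HOL-Library.FuncSet"
begin

text \<open>
  Linear problems in decisions \<open>x t e\<close> and uncertain variables \<open>\<zeta> s\<close>, where
  \<open>t, s \<in> {1..T+1}\<close> and \<open>e \<in> {1..E}\<close>. A linear form stands for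
  \<open>(\<Sum>t e. acoef t e * x t e) - (\<Sum>s. bcoef s * \<zeta> s)\<close> (note the minus sign);
  a constraint \<open>(f, c)\<close> stands for \<open>f \<le> c\<close>.
\<close>

record linear_form =
  acoef :: "nat \<Rightarrow> nat \<Rightarrow> real"
  bcoef :: "nat \<Rightarrow> real"

record linear_problem =
  objective_form :: linear_form
  constraint_list :: "(linear_form \<times> real) list"

definition form_value ::
  "nat \<Rightarrow> nat \<Rightarrow> linear_form \<Rightarrow> (nat \<Rightarrow> nat \<Rightarrow> real) \<Rightarrow> (nat \<Rightarrow> real) \<Rightarrow> real" where
  "form_value T E f x \<zeta> =
     (\<Sum>t=1..T+1. \<Sum>e=1..E. acoef f t e * x t e) - (\<Sum>s=1..T+1. bcoef f s * \<zeta> s)"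

definition num_constraints :: "linear_problem \<Rightarrow> nat" where
  "num_constraints P = length (constraint_list P)"

text \<open>Index 0 is the objective, indices \<open>1, \<dots>, m\<close> are the constraints.\<close>

definition row :: "linear_problem \<Rightarrow> nat \<Rightarrow> linear_form" where
  "row P i = (if i = 0 then objective_form P else fst (constraint_list P ! (i - 1)))"

text \<open>
  The subtuple \<open>(a i t e)\<close> over the pairs \<open>(t, e)\<close> with \<open>(t, s, e) \<in> A\<close> is a function
  restricted to that index set (\<open>undefined\<close> elsewhere), so two tuples are equal exactly when
  they agree in the \<open>b\<close>-component and on all these pairs.
\<close>

definition tuple_set ::
  "linear_problem \<Rightarrow> (nat \<times> nat \<times> nat) set \<Rightarrow> nat \<Rightarrow> (real \<times> (nat \<times> nat \<Rightarrow> real)) set" where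
  "tuple_set P A s =
     (\<Union>i\<in>{0..num_constraints P}.
        {(bcoef (row P i) s,
          restrict (\<lambda>(t, e). acoef (row P i) t e) {(t, e). (t, s, e) \<in> A})})"

definition num_tuples :: "linear_problem \<Rightarrow> (nat \<times> nat \<times> nat) set \<Rightarrow> nat \<Rightarrow> nat" where
  "num_tuples P A s = card (tuple_set P A s)"

definition total_num_tuples :: "nat \<Rightarrow> linear_problem \<Rightarrow> (nat \<times> nat \<times> nat) set \<Rightarrow> nat" where
  "total_num_tuples T P A = (\<Sum>s=1..T+1. num_tuples P A s)"


text \<open>The production-inventory problem without lead times, with its original constraints.\<close>

definition pi_cost ::
  "nat \<Rightarrow> nat \<Rightarrow> (nat \<Rightarrow> nat \<Rightarrow> real) \<Rightarrow> (nat \<Rightarrow> nat \<Rightarrow> real) \<Rightarrow> real" where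
  "pi_cost T E c x = (\<Sum>t=1..T+1. \<Sum>e=1..E. c t e * x t e)"

definition pi_feasible ::
  "nat \<Rightarrow> nat \<Rightarrow> (nat \<Rightarrow> nat \<Rightarrow> real) \<Rightarrow> (nat \<Rightarrow> real) \<Rightarrow> real \<Rightarrow> real \<Rightarrow> real
    \<Rightarrow> (nat \<Rightarrow> nat \<Rightarrow> real) \<Rightarrow> (nat \<Rightarrow> real) \<Rightarrow> bool" where
  "pi_feasible T E p Q Vmin Vmax v1 x \<zeta> \<longleftrightarrow>
     (\<forall>e\<in>{1..E}. (\<Sum>t=1..T+1. x t e) \<le> Q e) \<and>
     (\<forall>e\<in>{1..E}. \<forall>t\<in>{1..T+1}. 0 \<le> x t e \<and> x t e \<le> p t e) \<and>
     (\<forall>t\<in>{1..T}.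
        Vmin \<le> v1 + (\<Sum>e=1..E. \<Sum>l=1..t. x l e) - (\<Sum>s=2..t+1. \<zeta> s) \<and>
        v1 + (\<Sum>e=1..E. \<Sum>l=1..t. x l e) - (\<Sum>s=2..t+1. \<zeta> s) \<le> Vmax)"

text \<open>
  The same problem in the linear form above: two-sided constraints are split, and all constants
  are moved to the right-hand side. The lemmas \<open>pi_objective_value\<close> and
  \<open>pi_constraints_iff_feasible\<close> below relate it to \<open>pi_cost\<close> and \<open>pi_feasible\<close>.
\<close>

definition quota_constraint :: "(nat \<Rightarrow> real) \<Rightarrow> nat \<Rightarrow> linear_form \<times> real" where
  "quota_constraint Q e =
     (\<lparr>acoef = (\<lambda>t' e'. if e' = e then 1 else 0), bcoef = (\<lambda>s. 0)\<rparr>, Q e)"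

definition nonneg_constraint :: "nat \<Rightarrow> nat \<Rightarrow> linear_form \<times> real" where
  "nonneg_constraint t e =
     (\<lparr>acoef = (\<lambda>t' e'. if t' = t \<and> e' = e then - 1 else 0), bcoef = (\<lambda>s. 0)\<rparr>, 0)"

definition capacity_constraint ::
  "(nat \<Rightarrow> nat \<Rightarrow> real) \<Rightarrow> nat \<Rightarrow> nat \<Rightarrow> linear_form \<times> real" where
  "capacity_constraint p t e =
     (\<lparr>acoef = (\<lambda>t' e'. if t' = t \<and> e' = e then 1 else 0), bcoef = (\<lambda>s. 0)\<rparr>, p t e)"

definition inventory_lower_constraint :: "real \<Rightarrow> real \<Rightarrow> nat \<Rightarrow> linear_form \<times> real" where
  "inventory_lower_constraint Vmin v1 t =
     (\<lparr>acoef = (\<lambda>l e. if l \<le> t then - 1 else 0),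
       bcoef = (\<lambda>s. if 2 \<le> s \<and> s \<le> t + 1 then - 1 else 0)\<rparr>, v1 - Vmin)"

definition inventory_upper_constraint :: "real \<Rightarrow> real \<Rightarrow> nat \<Rightarrow> linear_form \<times> real" where
  "inventory_upper_constraint Vmax v1 t =
     (\<lparr>acoef = (\<lambda>l e. if l \<le> t then 1 else 0),
       bcoef = (\<lambda>s. if 2 \<le> s \<and> s \<le> t + 1 then 1 else 0)\<rparr>, Vmax - v1)"

definition pi_problem ::
  "nat \<Rightarrow> nat \<Rightarrow> (nat \<Rightarrow> nat \<Rightarrow> real) \<Rightarrow> (nat \<Rightarrow> nat \<Rightarrow> real) \<Rightarrow> (nat \<Rightarrow> real)
    \<Rightarrow> real \<Rightarrow> real \<Rightarrow> real \<Rightarrow> linear_problem" where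
  "pi_problem T E c p Q Vmin Vmax v1 =
     \<lparr>objective_form = \<lparr>acoef = c, bcoef = (\<lambda>s. 0)\<rparr>,
      constraint_list =
        map (quota_constraint Q) [1..<E+1] @
        map (\<lambda>(t, e). nonneg_constraint t e) (List.product [1..<T+2] [1..<E+1]) @
        map (\<lambda>(t, e). capacity_constraint p t e) (List.product [1..<T+2] [1..<E+1]) @
        map (inventory_lower_constraint Vmin v1) [1..<T+1] @
        map (inventory_upper_constraint Vmax v1) [1..<T+1]\<rparr>"

lemma pi_num_constraints:
  "num_constraints (pi_problem T E c p Q Vmin Vmax v1) = E + 2 * E * (T + 1) + 2 * T"
  by (simp add: num_constraints_def pi_problem_def)

lemma pi_objective_value:
  "form_value T E (objective_form (pi_problem T E c p Q Vmin Vmax v1)) x \<zeta> = pi_cost T E c x"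
  by (simp add: form_value_def pi_problem_def pi_cost_def)

lemma quota_constraint_value:
  assumes "e \<in> {1..E}"
  shows "form_value T E (fst (quota_constraint Q e)) x \<zeta> = (\<Sum>t=1..T+1. x t e)"
  using assms by (simp add: form_value_def quota_constraint_def if_distrib[of "\<lambda>a. a * _"] cong: if_cong)

lemma sum_single_pair:
  fixes k :: real and t e n E :: nat
  assumes "t \<in> {1..n}" "e \<in> {1..E}"
  shows "(\<Sum>t'=1..n. \<Sum>e'=1..E. (if t' = t \<and> e' = e then k else 0) * x t' e') = k * x t e"
proof -
  have "(\<Sum>t'=1..n. \<Sum>e'=1..E. (if t' = t \<and> e' = e then k else 0) * x t' e')
      = (\<Sum>t'=1..n. if t' = t then k * x t e else 0)"
    using assms(2)
    by (intro sum.cong refl) (simp add: if_distrib[of "\<lambda>a. a * _"] cong: if_cong)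
  then show ?thesis
    using assms(1) by simp
qed

lemma nonneg_constraint_value:
  assumes "t \<in> {1..T+1}" "e \<in> {1..E}"
  shows "form_value T E (fst (nonneg_constraint t e)) x \<zeta> = - x t e"
  using sum_single_pair[OF assms, of "- 1" x]
  by (simp add: form_value_def nonneg_constraint_def del: sum.cl_ivl_Suc)

lemma capacity_constraint_value:
  assumes "t \<in> {1..T+1}" "e \<in> {1..E}"
  shows "form_value T E (fst (capacity_constraint p t e)) x \<zeta> = x t e"
  using sum_single_pair[OF assms, of 1 x]
  by (simp add: form_value_def capacity_constraint_def del: sum.cl_ivl_Suc)

lemma sum_prefix_decisions:
  fixes k :: real and t T E :: nat
  assumes "t \<in> {1..T}"
  shows "(\<Sum>l=1..T+1. \<Sum>e=1..E. (if l \<le> t then k else 0) * x l e)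
       = k * (\<Sum>e=1..E. \<Sum>l=1..t. x l e)"
proof -
  have "(\<Sum>l=1..T+1. \<Sum>e=1..E. (if l \<le> t then k else 0) * x l e)
      = (\<Sum>l=1..t. \<Sum>e=1..E. (if l \<le> t then k else 0) * x l e)"
    using assms by (intro sum.mono_neutral_right) auto
  also have "\<dots> = k * (\<Sum>l=1..t. \<Sum>e=1..E. x l e)"
    by (simp add: sum_distrib_left)
  also have "(\<Sum>l=1..t. \<Sum>e=1..E. x l e) = (\<Sum>e=1..E. \<Sum>l=1..t. x l e)"
    by (rule sum.swap)
  finally show ?thesis .
qed

lemma sum_prefix_uncertain:
  fixes k :: real and t T :: nat
  assumes "t \<in> {1..T}"
  shows "(\<Sum>s=1..T+1. (if 2 \<le> s \<and> s \<le> t + 1 then k else 0) * \<zeta> s) = k * (\<Sum>s=2..t+1. \<zeta> s)"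
proof -
  have "(\<Sum>s=1..T+1. (if 2 \<le> s \<and> s \<le> t + 1 then k else 0) * \<zeta> s)
      = (\<Sum>s=2..t+1. (if 2 \<le> s \<and> s \<le> t + 1 then k else 0) * \<zeta> s)"
    using assms by (intro sum.mono_neutral_right) auto
  also have "\<dots> = (\<Sum>s=2..t+1. k * \<zeta> s)"
    by (rule sum.cong) auto
  finally show ?thesis
    by (simp only: sum_distrib_left)
qed

lemma inventory_lower_constraint_value:
  assumes "t \<in> {1..T}"
  shows "form_value T E (fst (inventory_lower_constraint Vmin v1 t)) x \<zeta>
       = (\<Sum>s=2..t+1. \<zeta> s) - (\<Sum>e=1..E. \<Sum>l=1..t. x l e)"
  using sum_prefix_decisions[OF assms, where k = "- 1" and E = E and x = x]
    sum_prefix_uncertain[OF assms, where k = "- 1" and \<zeta> = \<zeta>]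
  by (simp add: form_value_def inventory_lower_constraint_def del: sum.cl_ivl_Suc)

lemma inventory_upper_constraint_value:
  assumes "t \<in> {1..T}"
  shows "form_value T E (fst (inventory_upper_constraint Vmax v1 t)) x \<zeta>
       = (\<Sum>e=1..E. \<Sum>l=1..t. x l e) - (\<Sum>s=2..t+1. \<zeta> s)"
  using sum_prefix_decisions[OF assms, where k = 1 and E = E and x = x]
    sum_prefix_uncertain[OF assms, where k = 1 and \<zeta> = \<zeta>]
  by (simp add: form_value_def inventory_upper_constraint_def del: sum.cl_ivl_Suc)

lemma pi_constraint_set:
  "set (constraint_list (pi_problem T E c p Q Vmin Vmax v1)) =
     quota_constraint Q ` {1..E} \<union>
     (\<lambda>(t, e). nonneg_constraint t e) ` ({1..T+1} \<times> {1..E}) \<union>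
     (\<lambda>(t, e). capacity_constraint p t e) ` ({1..T+1} \<times> {1..E}) \<union>
     inventory_lower_constraint Vmin v1 ` {1..T} \<union>
     inventory_upper_constraint Vmax v1 ` {1..T}"
proof -
  have "set [1..<n+1] = {1..n}" "set [1..<n+2] = {1..n+1}" for n
    by auto
  then show ?thesis
    by (simp add: pi_problem_def Un_assoc del: set_upt upt_Suc)
qed

lemma pi_constraints_iff_feasible:
  "(\<forall>(f, r) \<in> set (constraint_list (pi_problem T E c p Q Vmin Vmax v1)). form_value T E f x \<zeta> \<le> r)
     \<longleftrightarrow> pi_feasible T E p Q Vmin Vmax v1 x \<zeta>"
proof -
  let ?ok = "\<lambda>k. form_value T E (fst k) x \<zeta> \<le> snd k"
  have quota: "?ok (quota_constraint Q e) \<longleftrightarrow> (\<Sum>t=1..T+1. x t e) \<le> Q e"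
    if "e \<in> {1..E}" for e
    unfolding quota_constraint_value[OF that] by (simp add: quota_constraint_def)
  have nonneg: "?ok (nonneg_constraint t e) \<longleftrightarrow> 0 \<le> x t e"
    if "t \<in> {1..T+1}" "e \<in> {1..E}" for t e
    unfolding nonneg_constraint_value[OF that] by (simp add: nonneg_constraint_def)
  have capacity: "?ok (capacity_constraint p t e) \<longleftrightarrow> x t e \<le> p t e"
    if "t \<in> {1..T+1}" "e \<in> {1..E}" for t e
    unfolding capacity_constraint_value[OF that] by (simp add: capacity_constraint_def)
  have lower: "?ok (inventory_lower_constraint Vmin v1 t) \<longleftrightarrow>
      Vmin \<le> v1 + (\<Sum>e=1..E. \<Sum>l=1..t. x l e) - (\<Sum>s=2..t+1. \<zeta> s)" if "t \<in> {1..T}" for t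
    unfolding inventory_lower_constraint_value[OF that]
    by (auto simp: inventory_lower_constraint_def)
  have upper: "?ok (inventory_upper_constraint Vmax v1 t) \<longleftrightarrow>
      v1 + (\<Sum>e=1..E. \<Sum>l=1..t. x l e) - (\<Sum>s=2..t+1. \<zeta> s) \<le> Vmax" if "t \<in> {1..T}" for t
    unfolding inventory_upper_constraint_value[OF that]
    by (auto simp: inventory_upper_constraint_def)
  have "(\<forall>k \<in> set (constraint_list (pi_problem T E c p Q Vmin Vmax v1)). ?ok k) \<longleftrightarrow>
      (\<forall>e\<in>{1..E}. ?ok (quota_constraint Q e)) \<and>
      (\<forall>e\<in>{1..E}. \<forall>t\<in>{1..T+1}. ?ok (nonneg_constraint t e) \<and> ?ok (capacity_constraint p t e)) \<and>
      (\<forall>t\<in>{1..T}. ?ok (inventory_lower_constraint Vmin v1 t) \<and>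
        ?ok (inventory_upper_constraint Vmax v1 t))"
    unfolding pi_constraint_set
    by (simp only: ball_Un ball_simps split_paired_Ball_Sigma prod.case) blast
  also have "\<dots> \<longleftrightarrow> pi_feasible T E p Q Vmin Vmax v1 x \<zeta>"
    unfolding pi_feasible_def
    by (intro arg_cong2[where f = "(\<and>)"] ball_cong refl)
      (simp_all only: quota nonneg capacity lower upper)
  finally show ?thesis
    by (simp only: case_prod_unfold)
qed

end

theory Submission imports Defs begin

text \<open>
  Fix a stage \<open>s\<close>, let \<open>B\<close> be the set of pairs \<open>(t, e)\<close> with \<open>(t, s, e) \<in> A\<close> and let \<open>n\<close> be
  its size. Restricting a row to \<open>B\<close> destroys most of the information in it:

  \<^item> the objective gives one tuple and the \<open>E\<close> quotas at most \<open>E\<close>;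
  \<^item> a bound on a single decision \<open>x t e\<close> gives the zero tuple unless \<open>(t, e) \<in> B\<close>, so the sign
    and capacity constraints give at most \<open>2 * n\<close> nonzero tuples;
  \<^item> an inventory constraint of period \<open>t\<close> has a constant coefficient \<open>\<plusminus>1\<close> on the decisions of
    stages up to \<open>t\<close>. Its restriction changes only when \<open>t\<close> passes a stage occurring in
    \<open>B\<close>, so for either sign there are at most \<open>n\<close> nonzero restrictions.

  The last point needs a word on the \<open>b\<close>-component. It is \<open>0\<close> when \<open>t < s - 1\<close>, but then the
  restriction vanishes as well, since \<open>B\<close> only contains stages \<open>\<ge> s\<close> (decisions do not anticipate).
  Otherwise it is \<open>\<plusminus>1\<close>, or always \<open>0\<close> when \<open>s = 1\<close>. Hence the tuples with vanishing
  \<open>a\<close>-component contributed by sign, capacity and inventory constraints are among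
  \<open>(0, 0)\<close>, \<open>(1, 0)\<close> and \<open>(-1, 0)\<close>, which reduce to \<open>(0, 0)\<close> when \<open>s = 1\<close>.

  Altogether a stage has at most \<open>4 * n + E + 4\<close> tuples, and the first one at most \<open>4 * n + E + 2\<close>
  (\<open>pi_num_tuples_le\<close>). Since the sizes \<open>n\<close> add up to \<open>card A\<close>, summation over the \<open>T + 1\<close>
  stages gives \<open>4 * card A + E * T + E + 4 * T + 2\<close>, which is within the claimed bound because
  \<open>T \<ge> 1\<close>.
\<close>

definition slice :: "(nat \<times> nat \<times> nat) set \<Rightarrow> nat \<Rightarrow> (nat \<times> nat) set" where
  "slice A s = {(t, e). (t, s, e) \<in> A}"

definition form_tuple ::
  "(nat \<times> nat \<times> nat) set \<Rightarrow> nat \<Rightarrow> linear_form \<Rightarrow> real \<times> (nat \<times> nat \<Rightarrow> real)" where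
  "form_tuple A s f = (bcoef f s, restrict (\<lambda>(t, e). acoef f t e) (slice A s))"

lemma finite_slice:
  assumes "finite A"
  shows "finite (slice A s)"
proof -
  have "slice A s \<subseteq> (\<lambda>(t, s, e). (t, e)) ` A"
    by (force simp: slice_def)
  then show ?thesis
    using assms finite_surj by blast
qed

lemma sum_card_slice_le:
  assumes "finite A" "finite S"
  shows "(\<Sum>s\<in>S. card (slice A s)) \<le> card A"
proof -
  have "(\<Sum>s\<in>S. card (slice A s)) = card (SIGMA s:S. slice A s)"
    using assms by (simp add: finite_slice)
  also have "\<dots> \<le> card A"
    using assms(1)
    by (intro card_inj_on_le[where f = "\<lambda>(s, t, e). (t, s, e)"])
      (auto simp: slice_def inj_on_def)
  finally show ?thesis .
qed

lemma tuple_set_eq_image_form_tuple: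
  "tuple_set P A s =
     form_tuple A s ` insert (objective_form P) (fst ` set (constraint_list P))"
proof -
  let ?L = "constraint_list P"
  have "{0..length ?L} = insert 0 (Suc ` {..<length ?L})"
    by (simp only: atLeast0AtMost lessThan_Suc_atMost[symmetric] lessThan_Suc_eq_insert_0)
  moreover have "row P ` Suc ` {..<length ?L} = fst ` set ?L"
    unfolding image_image by (force simp: row_def in_set_conv_nth)
  ultimately have "row P ` {0..num_constraints P} =
      insert (objective_form P) (fst ` set ?L)"
    by (simp add: num_constraints_def row_def)
  moreover have "tuple_set P A s = form_tuple A s ` row P ` {0..num_constraints P}"
    by (auto simp: tuple_set_def form_tuple_def slice_def)
  ultimately show ?thesis
    by simp
qed

definition step_fun :: "(nat \<times> nat) set \<Rightarrow> real \<Rightarrow> nat \<Rightarrow> nat \<times> nat \<Rightarrow> real" where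
  "step_fun B k t = restrict (\<lambda>(l, e). if l \<le> t then k else 0) B"

text \<open>
  Lowering the threshold \<open>t\<close> to the largest stage of \<open>B\<close> below it does not change which
  elements of \<open>B\<close> lie under it; if there is no such stage, the restriction vanishes.
\<close>

lemma step_fun_cases:
  assumes "finite B"
  shows "step_fun B k t \<in> insert (restrict (\<lambda>_. 0) B) (step_fun B k ` fst ` B)"
proof (cases "\<exists>l\<in>fst ` B. l \<le> t")
  case False
  then have "step_fun B k t = restrict (\<lambda>_. 0) B"
    by (force simp: step_fun_def intro: restrict_ext)
  then show ?thesis
    by simp
next
  case True
  let ?M = "{l \<in> fst ` B. l \<le> t}"
  have M: "finite ?M" "?M \<noteq> {}"
    using assms True by auto
  have "Max ?M \<in> ?M"
    using M by (rule Max_in)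
  moreover have "l \<le> t \<longleftrightarrow> l \<le> Max ?M" if "l \<in> fst ` B" for l
    using that M(1) \<open>Max ?M \<in> ?M\<close> by (auto intro: Max_ge)
  then have "step_fun B k t = step_fun B k (Max ?M)"
    by (force simp: step_fun_def intro: restrict_ext)
  ultimately show ?thesis
    by blast
qed

lemma form_tuple_single_decision:
  assumes "acoef f = (\<lambda>t' e'. if t' = t \<and> e' = e then k else 0)" "bcoef f = (\<lambda>s. 0)"
  shows "form_tuple A s f \<in> insert (0, restrict (\<lambda>_. 0) (slice A s))
    ((\<lambda>q. (0, restrict (\<lambda>q'. if q' = q then k else 0) (slice A s))) ` slice A s)"
proof (cases "(t, e) \<in> slice A s")
  case True
  have "form_tuple A s f = (0, restrict (\<lambda>q'. if q' = (t, e) then k else 0) (slice A s))"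
    using assms by (auto simp: form_tuple_def intro!: restrict_ext)
  then show ?thesis
    using True by blast
next
  case False
  then have "form_tuple A s f = (0, restrict (\<lambda>_. 0) (slice A s))"
    using assms by (auto simp: form_tuple_def intro!: restrict_ext)
  then show ?thesis
    by simp
qed

text \<open>
  The hypothesis on \<open>slice A s\<close> is non-anticipation; it makes the \<open>a\<close>-component vanish whenever
  the demand of stage \<open>s\<close> lies beyond the horizon \<open>t + 1\<close> of the constraint.
\<close>

lemma form_tuple_inventory:
  assumes "acoef f = (\<lambda>l e. if l \<le> t then k else 0)"
    and "bcoef f = (\<lambda>s. if 2 \<le> s \<and> s \<le> t + 1 then k else 0)"
    and fin: "finite (slice A s)" and "1 \<le> s"
    and later: "\<And>l e. (l, e) \<in> slice A s \<Longrightarrow> s \<le> l"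
  defines "b \<equiv> if s = 1 then 0 else k"
  shows "form_tuple A s f \<in>
    {(0, restrict (\<lambda>_. 0) (slice A s)), (b, restrict (\<lambda>_. 0) (slice A s))} \<union>
    Pair b ` step_fun (slice A s) k ` fst ` slice A s"
proof (cases "s \<le> t + 1")
  case True
  then have "form_tuple A s f = (b, step_fun (slice A s) k t)"
    using assms by (auto simp: form_tuple_def step_fun_def)
  then show ?thesis
    using step_fun_cases[OF fin, of k t] by auto
next
  case False
  then have "form_tuple A s f = (0, restrict (\<lambda>_. 0) (slice A s))"
    using assms(1,2) by (fastforce simp: form_tuple_def intro!: restrict_ext dest: later)
  then show ?thesis
    by simp
qed

lemma card_Un_le_add:
  assumes "card X \<le> m" "card Y \<le> n"
  shows "card (X \<union> Y) \<le> m + n"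
  using card_Un_le[of X Y] assms by linarith

text \<open>
  The saving at \<open>s = 1\<close> matters: with \<open>4\<close> in every stage the sum would exceed the claimed
  bound for \<open>T < 3\<close>.
\<close>

lemma pi_num_tuples_le:
  assumes fin: "finite (slice A s)" and s: "1 \<le> s"
    and later: "\<And>l e. (l, e) \<in> slice A s \<Longrightarrow> s \<le> l"
  shows "num_tuples (pi_problem T E c p Q Vmin Vmax v1) A s
           \<le> 4 * card (slice A s) + E + (if s = 1 then 2 else 4)"
proof -
  let ?P = "pi_problem T E c p Q Vmin Vmax v1"
  let ?B = "slice A s"
  define b :: real where "b = (if s = 1 then 0 else 1)"
  define z :: "nat \<times> nat \<Rightarrow> real" where "z = restrict (\<lambda>_. 0) ?B"
  \<comment> \<open>\<open>Base\<close> takes the tuples in which the restriction to the slice is zero, three of which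
    coincide if \<open>b = 0\<close>; this leaves at most one tuple per element of the slice in each of the
    families \<open>Single\<close> and \<open>Steps\<close>.\<close>
  define Base where "Base = {form_tuple A s (objective_form ?P), (0, z), (b, z), (- b, z)}"
  define Quota where "Quota = (\<lambda>e. form_tuple A s (fst (quota_constraint Q e))) ` {1..E}"
  define Single :: "real \<Rightarrow> (real \<times> (nat \<times> nat \<Rightarrow> real)) set"
    where "Single k = (\<lambda>q. (0, restrict (\<lambda>q'. if q' = q then k else 0) ?B)) ` ?B" for k
  define Steps :: "real \<Rightarrow> (real \<times> (nat \<times> nat \<Rightarrow> real)) set"
    where "Steps k = Pair (k * b) ` step_fun ?B k ` fst ` ?B" for k
  let ?U = "Base \<union> Quota \<union> Single (- 1) \<union> Single 1 \<union> Steps (- 1) \<union> Steps 1"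
  have single: "card (Single k) \<le> card ?B" for k
    unfolding Single_def using fin by (rule card_image_le)
  have steps: "card (Steps k) \<le> card ?B" for k
    unfolding Steps_def image_image using fin by (rule card_image_le)
  have base: "(0, z) \<in> Base" "(b, z) \<in> Base" "(- b, z) \<in> Base"
    by (simp_all add: Base_def)
  have nonneg: "form_tuple A s (fst (nonneg_constraint t e)) \<in> ?U" for t e
  proof -
    have "form_tuple A s (fst (nonneg_constraint t e)) \<in> insert (0, z) (Single (- 1))"
      unfolding z_def Single_def
      by (rule form_tuple_single_decision[where t = t and e = e])
        (simp_all add: nonneg_constraint_def)
    also have "\<dots> \<subseteq> ?U"
      using base(1) by blast
    finally show ?thesis .
  qed
  have capacity: "form_tuple A s (fst (capacity_constraint p t e)) \<in> ?U" for t e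
  proof -
    have "form_tuple A s (fst (capacity_constraint p t e)) \<in> insert (0, z) (Single 1)"
      unfolding z_def Single_def
      by (rule form_tuple_single_decision[where t = t and e = e])
        (simp_all add: capacity_constraint_def)
    also have "\<dots> \<subseteq> ?U"
      using base(1) by blast
    finally show ?thesis .
  qed
  have lower: "form_tuple A s (fst (inventory_lower_constraint Vmin v1 t)) \<in> ?U" for t
  proof -
    have "form_tuple A s (fst (inventory_lower_constraint Vmin v1 t)) \<in>
        {(0, z), (if s = 1 then 0 else - 1, z)} \<union>
        Pair (if s = 1 then 0 else - 1) ` step_fun ?B (- 1) ` fst ` ?B"
      unfolding z_def
      by (rule form_tuple_inventory[where t = t])
        (use fin s later in \<open>simp_all add: inventory_lower_constraint_def\<close>)
    also have "(if s = 1 then 0 else - 1) = - b"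
      by (simp add: b_def)
    also have "{(0, z), (- b, z)} \<union> Pair (- b) ` step_fun ?B (- 1) ` fst ` ?B \<subseteq> ?U"
      using base by (simp add: Steps_def) blast
    finally show ?thesis .
  qed
  have upper: "form_tuple A s (fst (inventory_upper_constraint Vmax v1 t)) \<in> ?U" for t
  proof -
    have "form_tuple A s (fst (inventory_upper_constraint Vmax v1 t)) \<in>
        {(0, z), (b, z)} \<union> Pair b ` step_fun ?B 1 ` fst ` ?B"
      unfolding z_def b_def
      by (rule form_tuple_inventory[where t = t])
        (use fin s later in \<open>simp_all add: inventory_upper_constraint_def\<close>)
    also have "\<dots> \<subseteq> ?U"
      using base by (simp add: Steps_def)
    finally show ?thesis .
  qed
  have quota: "form_tuple A s (fst (quota_constraint Q e)) \<in> ?U" if "e \<in> {1..E}" for e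
    using that by (auto simp: Quota_def)
  have "tuple_set ?P A s \<subseteq> ?U"
  proof -
    have "form_tuple A s (objective_form ?P) \<in> ?U"
      by (simp add: Base_def)
    moreover have "form_tuple A s (fst k) \<in> ?U" if "k \<in> set (constraint_list ?P)" for k
      using that unfolding pi_constraint_set
      by (elim UnE imageE SigmaE)
        (use nonneg capacity lower upper quota in \<open>simp_all del: Un_iff\<close>)
    ultimately show ?thesis
      unfolding tuple_set_eq_image_form_tuple by blast
  qed
  moreover have "finite ?U"
    using fin by (simp add: Base_def Quota_def Single_def Steps_def)
  ultimately have "num_tuples ?P A s \<le> card ?U"
    unfolding num_tuples_def by (simp add: card_mono)
  also have "card ?U \<le> (if s = 1 then 2 else 4) + E + card ?B + card ?B + card ?B + card ?B"
  proof (intro card_Un_le_add)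
    show "card Base \<le> (if s = 1 then 2 else 4)"
      by (auto simp: Base_def b_def card_insert_if)
    show "card Quota \<le> E"
      unfolding Quota_def using card_image_le[of "{1..E}"] by force
  qed (rule single steps)+
  finally show ?thesis
    by simp
qed

theorem proposition1:
  fixes T E :: nat
    and c p :: "nat \<Rightarrow> nat \<Rightarrow> real" and Q :: "nat \<Rightarrow> real"
    and Vmin Vmax v1 :: real
    and A :: "(nat \<times> nat \<times> nat) set"
  assumes "T \<ge> 1" and "E \<ge> 1"
    and "\<And>e. e \<in> {1..E} \<Longrightarrow> p (T + 1) e = 0"
    and "A \<subseteq> {(t, s, e). 1 \<le> s \<and> s \<le> t \<and> t \<le> T + 1 \<and> e \<in> {1..E}}"
  shows "total_num_tuples T (pi_problem T E c p Q Vmin Vmax v1) A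
           \<le> 4 * card A + E * T + 5 * T + E + 1"
proof -
  let ?P = "pi_problem T E c p Q Vmin Vmax v1"
  have "A \<subseteq> {1..T+1} \<times> {1..T+1} \<times> {1..E}"
    using assms(4) by auto
  then have fin: "finite A"
    by (rule finite_subset) simp
  have "total_num_tuples T ?P A
      \<le> (\<Sum>s=1..T+1. 4 * card (slice A s) + E + (if s = 1 then 2 else 4))"
    unfolding total_num_tuples_def
  proof (rule sum_mono)
    fix s assume "s \<in> {1..T+1}"
    then show "num_tuples ?P A s \<le> 4 * card (slice A s) + E + (if s = 1 then 2 else 4)"
      using assms(4) by (intro pi_num_tuples_le finite_slice fin) (auto simp: slice_def)
  qed
  also have "\<dots> = 4 * (\<Sum>s=1..T+1. card (slice A s)) + (T + 1) * E
      + (\<Sum>s=1..T+1. if s = 1 then 2 else 4)"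
    by (simp only: sum.distrib sum_distrib_left sum_constant card_atLeastAtMost) simp
  also have "(\<Sum>s=1..T+1. if s = 1 then 2 else 4) = 4 * T + (2::nat)"
    by (induction T) auto
  also have "4 * (\<Sum>s=1..T+1. card (slice A s)) + (T + 1) * E + (4 * T + 2)
      \<le> 4 * card A + (T + 1) * E + (4 * T + 2)"
    using sum_card_slice_le[OF fin, of "{1..T+1}"] by simp
  also have "\<dots> \<le> 4 * card A + E * T + 5 * T + E + 1"
    using assms(1) by (simp add: algebra_simps)
  finally show ?thesis .
qed

end
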